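(* Let $T:V\to A$ be a relative Rota-Baxter operator on a Hom-Leibniz Poisson algebra $(A,\cdot,[,],\alpha)$ with respect to a representation $(V,\lambda^l,\lambda^r,\rho^l,\rho^r,\phi)$. Define on $V$ the bilinear operations $$u\diamond v:=\lambda^l(Tu)v+\lambda^r(Tv)u,\qquad [u,v]_T:=\rho^l(Tu)v+\rho^r(Tv)u\qquad (u,v\in V).$$ Then $(V,\diamond,[,]_T,\phi)$ is a Hom-Leibniz Poisson algebra.
   Context: All vector spaces are over a field $\mathbb K$ of characteristic $0$; $gl(V)$ is the space of linear endomorphisms of $V$, and juxtaposition of operators is composition. A Hom-associative algebra $(A,\cdot,\alpha)$ is a vector space $A$ with a bilinear product and a linear map $\alpha:A\to A$ such that $\alpha(x\cdot y)=\alpha(x)\cdot\alpha(y)$ and $(x\cdot y)\cdot\alpha(z)=\alpha(x)\cdot(y\cdot z)$. A (right) Hom-Leibniz algebra $(A,[,],\alpha)$ is a vector space with a bilinear bracket and a linear map $\alpha$ such that $\alpha([x,y])=[\alpha(x),\alpha(y)]$ and $[[x,y],\alpha(z)]=[\alpha(x),[y,z]]+[[x,z],\alpha(y)]$. A Hom-Leibniz Poisson algebra $(A,\cdot,[,],\alpha)$ is such that $(A,\cdot,\alpha)$ is Hom-associative, $(A,[,],\alpha)$ is Hom-Leibniz, and $[x\cdot y,\alpha(z)]=\alpha(x)\cdot[y,z]+[x,z]\cdot\alpha(y)$ for all $x,y,z\in A$. A representation of a Hom-associative algebra $(A,\cdot,\alpha)$ is $(V,\lambda^l,\lambda^r,\phi)$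 with $V$ a vector space, $\phi\in gl(V)$, and $\lambda^l,\lambda^r:A\to gl(V)$ linear such that for all $x,y\in A$: $\phi\lambda^l(x)=\lambda^l(\alpha(x))\phi$; $\phi\lambda^r(x)=\lambda^r(\alpha(x))\phi$; $\lambda^l(x\cdot y)\phi=\lambda^l(\alpha(x))\lambda^l(y)$; $\lambda^r(x\cdot y)\phi=\lambda^r(\alpha(y))\lambda^r(x)$; $\lambda^l(\alpha(x))\lambda^r(y)=\lambda^r(\alpha(y))\lambda^l(x)$. A representation of a Hom-Leibniz algebra $(A,[,],\alpha)$ is $(V,\rho^l,\rho^r,\phi)$ with $\phi\in gl(V)$ and $\rho^l,\rho^r:A\to gl(V)$ linear such that for all $x,y\in A$: $\rho^l(\alpha(x))\phi=\phi\rho^l(x)$; $\rho^r(\alpha(x))\phi=\phi\rho^r(x)$; $\rho^l([x,y])\phi=\rho^l(\alpha(x))\rho^l(y)+\rho^r(\alpha(y))\rho^l(x)$; $\rho^r(\alpha(y))\rho^l(x)=\rho^l(\alpha(x))\rho^r(y)+\rho^l([x,y])\phi$; $\rho^r(\alpha(y))\rho^r(x)=\rho^r([x,y])\phi+\rho^r(\alpha(x))\rho^r(y)$. A representation of a Hom-Leibniz Poisson algebra $(A,\cdot,[,],\alpha)$ is $(V,\lambda^l,\lambda^r,\rho^l,\rho^r,\phi)$ such that $(V,\lambda^l,\lambda^r,\phi)$ is a representation of $(A,\cdot,\alpha)$, $(V,\rho^l,\rho^r,\phi)$ is a representation of $(A,[,],\alpha)$, and for all $x,y\in A$: $\rho^r(\alpha(y))\lambda^l(x)=\lambda^l(\alpha(x))\rho^r(y)+\lambda^l([x,y])\phi$;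 $\rho^r(\alpha(y))\lambda^r(x)=\lambda^r([x,y])\phi+\lambda^r(\alpha(x))\rho^r(y)$; $\rho^l(x\cdot y)\phi=\lambda^l(\alpha(x))\rho^l(y)+\lambda^r(\alpha(y))\rho^l(x)$. A relative Rota-Baxter operator on $(A,\cdot,[,],\alpha)$ with respect to a representation $(V,\lambda^l,\lambda^r,\rho^l,\rho^r,\phi)$ is a linear map $T:V\to A$ with $T\phi=\alpha T$, $Tu\cdot Tv=T(\lambda^l(Tu)v+\lambda^r(Tv)u)$ and $[Tu,Tv]=T(\rho^l(Tu)v+\rho^r(Tv)u)$ for all $u,v\in V$. *)

theory Defs
  imports "HOL.Vector_Spaces"
begin

text \<open>
  Vector spaces are the library's \<^locale>\<open>vector_space\<close>: a scalar multiplication of a field of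
  characteristic 0 (class \<^class>\<open>field_char_0\<close>) on a whole type of class \<^class>\<open>ab_group_add\<close>.
\<close>

text \<open>
  A linear map from \<open>A\<close> into \<open>gl(V)\<close>, where \<open>gl(V)\<close> carries the pointwise operations, is the same
  as a map bilinear in its two (curried) arguments; this is how the actions of the representations
  below are expressed. \<open>Vector_Spaces.linear\<close> includes the vector space axioms of its domain and
  its codomain.
\<close>

definition bilinear_map ::
  "('k::field_char_0 \<Rightarrow> 'a::ab_group_add \<Rightarrow> 'a) \<Rightarrow> ('k \<Rightarrow> 'b::ab_group_add \<Rightarrow> 'b) \<Rightarrow>
   ('k \<Rightarrow> 'c::ab_group_add \<Rightarrow> 'c) \<Rightarrow> ('a \<Rightarrow> 'b \<Rightarrow> 'c) \<Rightarrow> bool" where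
  "bilinear_map s1 s2 s3 f \<longleftrightarrow>
     (\<forall>x. Vector_Spaces.linear s2 s3 (f x)) \<and> (\<forall>y. Vector_Spaces.linear s1 s3 (\<lambda>x. f x y))"

locale hom_associative_algebra =
  fixes scale :: "'k::field_char_0 \<Rightarrow> 'a::ab_group_add \<Rightarrow> 'a"
    and mul :: "'a \<Rightarrow> 'a \<Rightarrow> 'a" (infixl "\<cdot>" 70)
    and \<alpha> :: "'a \<Rightarrow> 'a"
  assumes mul_bilinear: "bilinear_map scale scale scale (\<cdot>)"
    and twist_linear: "Vector_Spaces.linear scale scale \<alpha>"
    and twist_mul: "\<alpha> (x \<cdot> y) = \<alpha> x \<cdot> \<alpha> y"
    and hom_assoc: "(x \<cdot> y) \<cdot> \<alpha> z = \<alpha> x \<cdot> (y \<cdot> z)"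

locale hom_leibniz_algebra =
  fixes scale :: "'k::field_char_0 \<Rightarrow> 'a::ab_group_add \<Rightarrow> 'a"
    and br :: "'a \<Rightarrow> 'a \<Rightarrow> 'a"
    and \<alpha> :: "'a \<Rightarrow> 'a"
  assumes br_bilinear: "bilinear_map scale scale scale br"
    and twist_linear: "Vector_Spaces.linear scale scale \<alpha>"
    and twist_br: "\<alpha> (br x y) = br (\<alpha> x) (\<alpha> y)"
    and hom_leibniz: "br (br x y) (\<alpha> z) = br (\<alpha> x) (br y z) + br (br x z) (\<alpha> y)"

locale hom_leibniz_poisson_algebra =
  hom_associative_algebra scale mul \<alpha> + leibniz: hom_leibniz_algebra scale br \<alpha>
  for scale :: "'k::field_char_0 \<Rightarrow> 'a::ab_group_add \<Rightarrow> 'a"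
    and mul :: "'a \<Rightarrow> 'a \<Rightarrow> 'a" (infixl "\<cdot>" 70)
    and br :: "'a \<Rightarrow> 'a \<Rightarrow> 'a"
    and \<alpha> :: "'a \<Rightarrow> 'a" +
  assumes hom_poisson: "br (x \<cdot> y) (\<alpha> z) = \<alpha> x \<cdot> br y z + br x z \<cdot> \<alpha> y"

locale hom_associative_representation =
  hom_associative_algebra scaleA mul \<alpha>
  for scaleA :: "'k::field_char_0 \<Rightarrow> 'a::ab_group_add \<Rightarrow> 'a"
    and mul :: "'a \<Rightarrow> 'a \<Rightarrow> 'a" (infixl "\<cdot>" 70)
    and \<alpha> :: "'a \<Rightarrow> 'a" +
  fixes scaleV :: "'k \<Rightarrow> 'v::ab_group_add \<Rightarrow> 'v"
    and lam_l lam_r :: "'a \<Rightarrow> 'v \<Rightarrow> 'v"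
    and \<phi> :: "'v \<Rightarrow> 'v"
  assumes phi_linear: "Vector_Spaces.linear scaleV scaleV \<phi>"
    and lam_l_linear: "bilinear_map scaleA scaleV scaleV lam_l"
    and lam_r_linear: "bilinear_map scaleA scaleV scaleV lam_r"
    and phi_lam_l: "\<phi> (lam_l x v) = lam_l (\<alpha> x) (\<phi> v)"
    and phi_lam_r: "\<phi> (lam_r x v) = lam_r (\<alpha> x) (\<phi> v)"
    and lam_l_mul: "lam_l (x \<cdot> y) (\<phi> v) = lam_l (\<alpha> x) (lam_l y v)"
    and lam_r_mul: "lam_r (x \<cdot> y) (\<phi> v) = lam_r (\<alpha> y) (lam_r x v)"
    and lam_l_lam_r: "lam_l (\<alpha> x) (lam_r y v) = lam_r (\<alpha> y) (lam_l x v)"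

locale hom_leibniz_representation =
  hom_leibniz_algebra scaleA br \<alpha>
  for scaleA :: "'k::field_char_0 \<Rightarrow> 'a::ab_group_add \<Rightarrow> 'a"
    and br :: "'a \<Rightarrow> 'a \<Rightarrow> 'a"
    and \<alpha> :: "'a \<Rightarrow> 'a" +
  fixes scaleV :: "'k \<Rightarrow> 'v::ab_group_add \<Rightarrow> 'v"
    and rho_l rho_r :: "'a \<Rightarrow> 'v \<Rightarrow> 'v"
    and \<phi> :: "'v \<Rightarrow> 'v"
  assumes phi_linear: "Vector_Spaces.linear scaleV scaleV \<phi>"
    and rho_l_linear: "bilinear_map scaleA scaleV scaleV rho_l"
    and rho_r_linear: "bilinear_map scaleA scaleV scaleV rho_r"
    and phi_rho_l: "rho_l (\<alpha> x) (\<phi> v) = \<phi> (rho_l x v)"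
    and phi_rho_r: "rho_r (\<alpha> x) (\<phi> v) = \<phi> (rho_r x v)"
    and rho_l_br: "rho_l (br x y) (\<phi> v) = rho_l (\<alpha> x) (rho_l y v) + rho_r (\<alpha> y) (rho_l x v)"
    and rho_r_rho_l: "rho_r (\<alpha> y) (rho_l x v) = rho_l (\<alpha> x) (rho_r y v) + rho_l (br x y) (\<phi> v)"
    and rho_r_rho_r: "rho_r (\<alpha> y) (rho_r x v) = rho_r (br x y) (\<phi> v) + rho_r (\<alpha> x) (rho_r y v)"

locale hom_leibniz_poisson_representation =
  hom_leibniz_poisson_algebra scaleA mul br \<alpha> +
  hom_associative_representation scaleA mul \<alpha> scaleV lam_l lam_r \<phi> +
  leibniz: hom_leibniz_representation scaleA br \<alpha> scaleV rho_l rho_r \<phi>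
  for scaleA :: "'k::field_char_0 \<Rightarrow> 'a::ab_group_add \<Rightarrow> 'a"
    and mul :: "'a \<Rightarrow> 'a \<Rightarrow> 'a" (infixl "\<cdot>" 70)
    and br :: "'a \<Rightarrow> 'a \<Rightarrow> 'a"
    and \<alpha> :: "'a \<Rightarrow> 'a"
    and scaleV :: "'k \<Rightarrow> 'v::ab_group_add \<Rightarrow> 'v"
    and lam_l lam_r rho_l rho_r :: "'a \<Rightarrow> 'v \<Rightarrow> 'v"
    and \<phi> :: "'v \<Rightarrow> 'v" +
  assumes rho_r_lam_l: "rho_r (\<alpha> y) (lam_l x v) = lam_l (\<alpha> x) (rho_r y v) + lam_l (br x y) (\<phi> v)"
    and rho_r_lam_r: "rho_r (\<alpha> y) (lam_r x v) = lam_r (br x y) (\<phi> v) + lam_r (\<alpha> x) (rho_r y v)"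
    and rho_l_mul: "rho_l (x \<cdot> y) (\<phi> v) = lam_l (\<alpha> x) (rho_l y v) + lam_r (\<alpha> y) (rho_l x v)"

locale relative_rota_baxter_operator =
  hom_leibniz_poisson_representation scaleA mul br \<alpha> scaleV lam_l lam_r rho_l rho_r \<phi>
  for scaleA :: "'k::field_char_0 \<Rightarrow> 'a::ab_group_add \<Rightarrow> 'a"
    and mul :: "'a \<Rightarrow> 'a \<Rightarrow> 'a" (infixl "\<cdot>" 70)
    and br :: "'a \<Rightarrow> 'a \<Rightarrow> 'a"
    and \<alpha> :: "'a \<Rightarrow> 'a"
    and scaleV :: "'k \<Rightarrow> 'v::ab_group_add \<Rightarrow> 'v"
    and lam_l lam_r rho_l rho_r :: "'a \<Rightarrow> 'v \<Rightarrow> 'v"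
    and \<phi> :: "'v \<Rightarrow> 'v" +
  fixes T :: "'v \<Rightarrow> 'a"
  assumes T_linear: "Vector_Spaces.linear scaleV scaleA T"
    and T_phi: "T (\<phi> u) = \<alpha> (T u)"
    and T_mul: "T u \<cdot> T v = T (lam_l (T u) v + lam_r (T v) u)"
    and T_br: "br (T u) (T v) = T (rho_l (T u) v + rho_r (T v) u)"

end

theory Submission
  imports Defs
begin

text \<open>
  \<open>T\<close> intertwines the induced operations with those of \<open>A\<close>, so in each of the three identities every
  nested operation acts through a product or bracket of values of \<open>T\<close>. The terms in which a given
  argument of the identity is the one acted upon then cancel by exactly one axiom of the
  representation.
\<close>

lemma bilinear_map_add_right:
  "bilinear_map s1 s2 s3 f \<Longrightarrow> f x (y + z) = f x y + f x z"
  unfolding bilinear_map_def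
  by (metis Vector_Spaces.linear.axioms(3) module_hom.add)

lemma bilinear_map_add:
  assumes "bilinear_map s1 s2 s3 f" and "bilinear_map s1 s2 s3 g"
  shows "bilinear_map s1 s2 s3 (\<lambda>x y. f x y + g x y)"
  using assms unfolding bilinear_map_def
  by (simp add: linear_iff_module_hom module_hom_iff module.scale_right_distrib algebra_simps)

lemma bilinear_map_flip:
  "bilinear_map s1 s2 s3 f \<Longrightarrow> bilinear_map s2 s1 s3 (\<lambda>x y. f y x)"
  by (simp add: bilinear_map_def)

lemma bilinear_map_comp_left:
  assumes "bilinear_map s1 s2 s3 f" and "Vector_Spaces.linear s0 s1 T"
  shows "bilinear_map s0 s2 s3 (\<lambda>x y. f (T x) y)"
  using assms Vector_Spaces.linear_compose[of s0 s1 T s3]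
  by (auto simp: bilinear_map_def comp_def)

context relative_rota_baxter_operator
begin

text \<open>Kept generic in the pair \<open>l\<close>, \<open>r\<close> so that it serves the
  product (\<open>lam_l\<close>, \<open>lam_r\<close>) and the bracket (\<open>rho_l\<close>,
  \<open>rho_r\<close>) alike. In the second summand it is \<open>v\<close> that acts, through
  \<open>T v\<close>, so precomposition with \<open>T\<close> gives bilinearity in the order
  \<open>v\<close>, \<open>u\<close>, and a flip restores the order \<open>u\<close>,
  \<open>v\<close>.\<close>

lemma bilinear_map_induced:
  assumes "bilinear_map scaleA scaleV scaleV l" and "bilinear_map scaleA scaleV scaleV r"
  shows "bilinear_map scaleV scaleV scaleV (\<lambda>u v. l (T u) v + r (T v) u)"
  using assms T_linear
  by (intro bilinear_map_add bilinear_map_flip[of _ _ _ "\<lambda>v u. r (T v) u"])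
     (auto intro: bilinear_map_comp_left)

lemmas action_add_right =
  lam_l_linear[THEN bilinear_map_add_right] lam_r_linear[THEN bilinear_map_add_right]
  leibniz.rho_l_linear[THEN bilinear_map_add_right]
  leibniz.rho_r_linear[THEN bilinear_map_add_right]

text \<open>Supplies additivity of \<open>\<phi>\<close> and lets \<open>unfold_locales\<close>
  below discharge the linearity of the twist.\<close>

interpretation phi: Vector_Spaces.linear scaleV scaleV \<phi>
  by (rule phi_linear)

sublocale induced: hom_leibniz_poisson_algebra scaleV
  "\<lambda>u v. lam_l (T u) v + lam_r (T v) u" "\<lambda>u v. rho_l (T u) v + rho_r (T v) u" \<phi>
proof unfold_locales
  show "bilinear_map scaleV scaleV scaleV (\<lambda>u v. lam_l (T u) v + lam_r (T v) u)"
    by (intro bilinear_map_induced lam_l_linear lam_r_linear)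
  show "bilinear_map scaleV scaleV scaleV (\<lambda>u v. rho_l (T u) v + rho_r (T v) u)"
    by (intro bilinear_map_induced leibniz.rho_l_linear leibniz.rho_r_linear)
  fix u v w
  show "\<phi> (lam_l (T u) v + lam_r (T v) u) = lam_l (T (\<phi> u)) (\<phi> v) + lam_r (T (\<phi> v)) (\<phi> u)"
    by (simp add: phi.add phi_lam_l phi_lam_r T_phi)
  show "\<phi> (rho_l (T u) v + rho_r (T v) u) = rho_l (T (\<phi> u)) (\<phi> v) + rho_r (T (\<phi> v)) (\<phi> u)"
    by (simp add: phi.add leibniz.phi_rho_l leibniz.phi_rho_r T_phi)
  show "lam_l (T (lam_l (T u) v + lam_r (T v) u)) (\<phi> w) +
      lam_r (T (\<phi> w)) (lam_l (T u) v + lam_r (T v) u) =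
    lam_l (T (\<phi> u)) (lam_l (T v) w + lam_r (T w) v) +
      lam_r (T (lam_l (T v) w + lam_r (T w) v)) (\<phi> u)"
    \<comment> \<open>Read from right to left, \<open>T_mul\<close> folds \<open>T\<close> of an
      induced product into a product in \<open>A\<close>. The terms in \<open>w\<close>,
      \<open>v\<close>, \<open>u\<close> then agree by \<open>lam_l_mul\<close>,
      \<open>lam_l_lam_r\<close> and \<open>lam_r_mul\<close> respectively.\<close>
    by (simp add: T_mul[symmetric] T_phi action_add_right lam_l_mul lam_r_mul lam_l_lam_r)
  show "rho_l (T (rho_l (T u) v + rho_r (T v) u)) (\<phi> w) +
      rho_r (T (\<phi> w)) (rho_l (T u) v + rho_r (T v) u) =
    rho_l (T (\<phi> u)) (rho_l (T v) w + rho_r (T w) v) +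
      rho_r (T (rho_l (T v) w + rho_r (T w) v)) (\<phi> u) +
    (rho_l (T (rho_l (T u) w + rho_r (T w) u)) (\<phi> v) +
      rho_r (T (\<phi> v)) (rho_l (T u) w + rho_r (T w) u))"
    \<comment> \<open>The three instances match the terms in \<open>w\<close>, \<open>v\<close>,
      \<open>u\<close> in this order. They are instantiated because \<open>rho_r_rho_r\<close> as a
      general rewrite rule loops: its right side contains its left side with \<open>x\<close> and
      \<open>y\<close> exchanged.\<close>
    using leibniz.rho_l_br[of "T u" "T v" w] leibniz.rho_r_rho_l[of "T w" "T u" v]
      leibniz.rho_r_rho_r[of "T w" "T v" u]
    by (simp add: T_br[symmetric] T_phi action_add_right)
  show "rho_l (T (lam_l (T u) v + lam_r (T v) u)) (\<phi> w) +
      rho_r (T (\<phi> w)) (lam_l (T u) v + lam_r (T v) u) =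
    lam_l (T (\<phi> u)) (rho_l (T v) w + rho_r (T w) v) +
      lam_r (T (rho_l (T v) w + rho_r (T w) v)) (\<phi> u) +
    (lam_l (T (rho_l (T u) w + rho_r (T w) u)) (\<phi> v) +
      lam_r (T (\<phi> v)) (rho_l (T u) w + rho_r (T w) u))"
    \<comment> \<open>Here the compatibility axioms can rewrite freely, since each turns an outer
      \<open>rho\<close> into outer \<open>lam\<close> actions: \<open>rho_l_mul\<close> settles the
      terms in \<open>w\<close>, \<open>rho_r_lam_l\<close> those in \<open>v\<close>,
      \<open>rho_r_lam_r\<close> those in \<open>u\<close>.\<close>
    by (simp add: T_mul[symmetric] T_br[symmetric] T_phi action_add_right
        rho_l_mul rho_r_lam_l rho_r_lam_r)
qed

end

theorem lemma4p16:
  fixes scaleA :: "'k::field_char_0 \<Rightarrow> 'a::ab_group_add \<Rightarrow> 'a"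
    and scaleV :: "'k \<Rightarrow> 'v::ab_group_add \<Rightarrow> 'v"
    and mul br :: "'a \<Rightarrow> 'a \<Rightarrow> 'a"
    and \<alpha> :: "'a \<Rightarrow> 'a"
    and lam_l lam_r rho_l rho_r :: "'a \<Rightarrow> 'v \<Rightarrow> 'v"
    and \<phi> :: "'v \<Rightarrow> 'v"
    and T :: "'v \<Rightarrow> 'a"
  assumes "hom_leibniz_poisson_algebra scaleA mul br \<alpha>"
    and "hom_leibniz_poisson_representation scaleA mul br \<alpha> scaleV lam_l lam_r rho_l rho_r \<phi>"
    and "relative_rota_baxter_operator scaleA mul br \<alpha> scaleV lam_l lam_r rho_l rho_r \<phi> T"
  shows "hom_leibniz_poisson_algebra scaleV
           (\<lambda>u v. lam_l (T u) v + lam_r (T v) u)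
           (\<lambda>u v. rho_l (T u) v + rho_r (T v) u)
           \<phi>"
proof -
  interpret relative_rota_baxter_operator scaleA mul br \<alpha> scaleV lam_l lam_r rho_l rho_r \<phi> T
    by (rule assms(3))
  show ?thesis
    by (rule induced.hom_leibniz_poisson_algebra_axioms)
qed

end
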